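(* Let $$A(x,y)=-\frac{y\,\log\bigl((1-x)(1-xy)\bigr)}{(1+y-xy)^2}+\frac{x\,y^2}{(1-xy)(1+y-xy)}+\frac{1}{1-x},$$ regarded as a formal power series in $x,y$. Then $A(x,y)$ is the generating function of the triangle of reciprocal binomial coefficients, i.e. for all integers $0\le m\le n$, $$[x^n y^m]\,A(x,y)=\binom{n}{m}^{-1},$$ and $[x^n y^m]A(x,y)=0$ for $m>n\ge 0$; equivalently $A(x,y)=\sum_{n\ge 0}\sum_{m=0}^{n}\binom{n}{m}^{-1}x^n y^m$.
   Context: $[x^n y^m]G(x,y)$ denotes the coefficient of $x^n y^m$ in the expansion of $G(x,y)$ as a formal power series in $x,y$ (expansion at the origin). Here $\log$ is the formal logarithm, $\log(1+u)=\sum_{k\ge 1}\frac{(-1)^{k-1}}{k}u^k$ for a power series $u$ without constant term, and $1/(1+u)$ is expanded as a geometric series. All identities are in the ring $\mathbb{C}[[x,y]]$. *)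

theory Defs
  imports "HOL-Computational_Algebra.Formal_Power_Series" Complex_Main
begin

text \<open>
  \<open>\<complex>[[x,y]]\<close> is represented as \<open>(\<complex>[[y]])[[x]]\<close>: the outer series is in \<open>x\<close>, and its
  coefficients are series in \<open>y\<close>.
\<close>

type_synonym bfps = "complex fps fps"

definition bfps_X :: bfps where
  "bfps_X = fps_X"

definition bfps_Y :: bfps where
  "bfps_Y = fps_const fps_X"

definition bfps_const :: "complex \<Rightarrow> bfps" where
  "bfps_const c = fps_const (fps_const c)"

definition bcoeff :: "nat \<Rightarrow> nat \<Rightarrow> bfps \<Rightarrow> complex" where
  "bcoeff n m F = fps_nth (fps_nth F n) m"

lemma bcoeff_monomial:
  "bcoeff n m (bfps_const c * bfps_X ^ i * bfps_Y ^ j) = (if n = i \<and> m = j then c else 0)"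
proof -
  have "bfps_const c * bfps_X ^ i * bfps_Y ^ j = fps_const (fps_const c * fps_X ^ j) * fps_X ^ i"
    by (simp add: bfps_const_def bfps_X_def bfps_Y_def fps_const_power mult_ac
          flip: fps_const_mult)
  then show ?thesis
    by (auto simp: bcoeff_def fps_X_power_iff)
qed

text \<open>
  The formal logarithm of \<open>F = 1 + u\<close> for \<open>u\<close> without constant term, i.e. the sum over \<open>k \<ge> 1\<close>
  of \<open>(-1)^(k-1) / k * u^k\<close>. For each coefficient the sum may be cut off at \<open>k = n + m\<close>,
  since \<open>u^k\<close> only has terms of total degree at least \<open>k\<close> (\<open>bcoeff_power_eq_0\<close>).
\<close>

definition bfps_log :: "bfps \<Rightarrow> bfps" where
  "bfps_log F = Abs_fps (\<lambda>n. Abs_fps (\<lambda>m.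
     \<Sum>k = 1..n + m. (-1) ^ (k - 1) / of_nat k * bcoeff n m ((F - 1) ^ k)))"

lemma bcoeff_mult:
  "bcoeff n m (F * G) = (\<Sum>i = 0..n. \<Sum>j = 0..m. bcoeff i j F * bcoeff (n - i) (m - j) G)"
  by (simp add: bcoeff_def fps_mult_nth fps_sum_nth)

lemma bcoeff_power_eq_0:
  assumes "bcoeff 0 0 u = 0" "n + m < k"
  shows "bcoeff n m (u ^ k) = 0"
  using assms(2)
proof (induction k arbitrary: n m)
  case (Suc k)
  have "bcoeff i j u * bcoeff (n - i) (m - j) (u ^ k) = 0" if "i \<le> n" "j \<le> m" for i j
  proof (cases "i = 0 \<and> j = 0")
    case False
    then have "(n - i) + (m - j) < k"
      using that Suc.prems by linarith
    then show ?thesis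
      by (simp add: Suc.IH)
  qed (use assms(1) in simp)
  then show ?case
    unfolding power_Suc bcoeff_mult by (intro sum.neutral ballI) auto
qed simp

text \<open>
  For a denominator with nonzero constant term, the division of the library on \<open>complex fps fps\<close>
  is division in \<open>\<complex>[[x,y]]\<close>, that is, multiplication by the unique inverse (which for \<open>1 + u\<close> is
  the geometric series).
\<close>

lemma bfps_divide_mult:
  fixes F G :: bfps
  assumes "bcoeff 0 0 G \<noteq> 0"
  shows "F / G * G = F"
proof -
  have nz: "fps_nth (fps_nth G 0) 0 \<noteq> 0"
    using assms by (simp add: bcoeff_def)
  then have nz': "fps_nth G 0 \<noteq> 0"
    by auto
  have "F / G = F * inverse G"
    using nz' by (simp add: fps_divide_def fps_unit_factor_def)
  moreover have "G * inverse G = 1"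
    using fps_right_inverse[OF inverse_mult_eq_1'[OF nz]]
    by (simp only: fps_inverse_def[of G])
  ultimately show ?thesis
    by (simp add: mult.assoc mult.commute[of "inverse G"])
qed

lemma bfps_inverse_geometric:
  fixes u :: bfps
  assumes "bcoeff 0 0 u = 0"
  shows "bcoeff n m (1 / (1 + u)) = (\<Sum>k = 0..n + m. (-1) ^ k * bcoeff n m (u ^ k))"
proof -
  have c: "bcoeff 0 0 (1 + u) \<noteq> 0"
    using assms by (simp add: bcoeff_def)
  define S where "S = (\<Sum>k<Suc (n + m). (- u) ^ k)"
  define K where "K = Suc (n + m)"
  have "(1 + u) * S = 1 - (- u) ^ K"
    using one_diff_power_eq[of "- u" K] by (simp add: S_def K_def)
  then have "1 / (1 + u) * ((1 + u) * S) = 1 / (1 + u) * (1 - (- u) ^ K)"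
    by simp
  then have "(1 / (1 + u) * (1 + u)) * S = 1 / (1 + u) * (1 - (- u) ^ K)"
    by (simp only: mult.assoc)
  then have "S = 1 / (1 + u) * (1 - (- u) ^ K)"
    by (simp only: bfps_divide_mult[OF c] mult_1_left)
  then have eq: "S = 1 / (1 + u) - (- u) ^ K * (1 / (1 + u))"
    by (simp only: right_diff_distrib mult_1_right mult.commute[of "1 / (1 + u)"])
  have "bcoeff n m ((- u) ^ K * (1 / (1 + u))) = 0"
    unfolding bcoeff_mult
  proof (intro sum.neutral ballI)
    fix i j assume "i \<in> {0..n}" "j \<in> {0..m}"
    then have "bcoeff i j ((- u) ^ K) = 0"
      using assms by (intro bcoeff_power_eq_0) (auto simp: K_def bcoeff_def)
    then show "bcoeff i j ((- u) ^ K) * bcoeff (n - i) (m - j) (1 / (1 + u)) = 0"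
      by simp
  qed
  then have "bcoeff n m (1 / (1 + u)) = bcoeff n m S"
    unfolding eq by (simp add: bcoeff_def)
  also have "\<dots> = (\<Sum>k<Suc (n + m). bcoeff n m ((- u) ^ k))"
    by (simp add: S_def bcoeff_def fps_sum_nth)
  also have "\<dots> = (\<Sum>k = 0..n + m. (-1) ^ k * bcoeff n m (u ^ k))"
  proof (rule sum.cong)
    show "{..<Suc (n + m)} = {0..n + m}" by auto
    show "bcoeff n m ((- u) ^ k) = (-1) ^ k * bcoeff n m (u ^ k)" for k
      by (cases "even k") (simp_all add: bcoeff_def)
  qed
  finally show ?thesis .
qed

definition A_series :: bfps where
  "A_series = (let x = bfps_X; y = bfps_Y in
     - (y * bfps_log ((1 - x) * (1 - x * y)) / (1 + y - x * y) ^ 2)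
     + x * y ^ 2 / ((1 - x * y) * (1 + y - x * y))
     + 1 / (1 - x))"

end

theory Submission
  imports Defs
begin

text \<open>
  Write \<open>D = 1 + y - x y\<close> for the base of the quadratic denominator and \<open>B\<close> for the series of
  reciprocal binomial coefficients, with \<open>B\<^sub>n(y)\<close> for its coefficient of \<open>x\<^sup>n\<close>.
  Everything rests on one replacement for Pascal's rule: the sum of two neighbouring reciprocals
  \<open>1 / (n+1 choose k+1) + 1 / (n+1 choose k)\<close> is \<open>(n+2) / (n+1)\<close> times
  \<open>1 / (n choose k)\<close> (\<open>reciprocal_binomial_add\<close>). Since the factor is
  \<open>1 + 1 / (n+1)\<close>, multiplying \<open>B\<close> by \<open>D\<close> cancels the part without denominator:
  in row \<open>n + 1\<close> only the two boundary terms \<open>1\<close>, \<open>y^(n+2)\<close> and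
  \<open>y B\<^sub>n / (n+1)\<close> survive. A second multiplication by \<open>D\<close> removes \<open>B\<^sub>n\<close> as well, and
  in row \<open>n + 1\<close> leaves \<open>1 + y^(n+3) + y (1 + y^(n+1)) / (n+1)\<close>. This is why the denominator of
  the logarithmic term is a square, and the last summand is the logarithm:
  the coefficient of \<open>x^n\<close> in \<open>log ((1 - x) (1 - x y))\<close> is \<open>- (1 + y^n) / n\<close>
  for positive \<open>n\<close> (\<open>log_product_nth\<close>).

  So \<open>D\<^sup>2 B\<close> has a closed form (\<open>reciprocal_triangle_mult\<close>), which clearing denominators shows
  to be \<open>D\<^sup>2\<close> times the claimed generating function. Power series over a field form an integral
  domain, as do power series over these, so \<open>D\<^sup>2\<close> may be cancelled.

  The logarithm of the product is obtained without a functional equation: differentiating in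
  \<open>x\<close> turns the defining series of \<open>log F\<close> into a geometric series, so that
  \<open>(log F)' F = F'\<close> (\<open>deriv_bfps_log_mult\<close>), and for \<open>F = (1 - x) (1 - x y)\<close> the quotient
  \<open>F' / F\<close> splits into two geometric series whose coefficients can be read off.
\<close>

section \<open>The derivative of the formal logarithm\<close>

lemma bfps_eqI: "(\<And>n m. bcoeff n m F = bcoeff n m G) \<Longrightarrow> F = G"
  by (simp add: bcoeff_def fps_eq_iff)

lemma bcoeff_sum: "bcoeff n m (\<Sum>k\<in>A. f k) = (\<Sum>k\<in>A. bcoeff n m (f k))"
  by (simp add: bcoeff_def fps_sum_nth)

lemma bcoeff_mult_cong:
  assumes "\<And>i j. i \<le> n \<Longrightarrow> j \<le> m \<Longrightarrow> bcoeff i j F = bcoeff i j G"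
  shows "bcoeff n m (F * H) = bcoeff n m (G * H)"
  unfolding bcoeff_mult using assms by (intro sum.cong refl) auto

lemma bcoeff_deriv: "bcoeff n m (fps_deriv F) = of_nat (Suc n) * bcoeff (Suc n) m F"
  by (simp add: bcoeff_def fps_of_nat[symmetric] del: of_nat_Suc)

text \<open>
  The cut-off in the definition of the logarithm varies with the coefficient. Here it is replaced by
  a common one for a whole range of coefficients, so that the logarithm can be treated as a single
  polynomial in \<open>F - 1\<close>.
\<close>

lemma bcoeff_log_truncate:
  assumes "bcoeff 0 0 F = 1" "n + m \<le> K"
  shows "bcoeff n m (bfps_log F)
       = (\<Sum>k<K. (-1) ^ k / of_nat (Suc k) * bcoeff n m ((F - 1) ^ Suc k))"
proof -
  have "bcoeff n m (bfps_log F)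
      = (\<Sum>k = 1..n + m. (-1) ^ (k - 1) / of_nat k * bcoeff n m ((F - 1) ^ k))"
    by (simp add: bcoeff_def bfps_log_def)
  also have "\<dots> = (\<Sum>k = 1..K. (-1) ^ (k - 1) / of_nat k * bcoeff n m ((F - 1) ^ k))"
  proof (rule sum.mono_neutral_left)
    have "bcoeff 0 0 (F - 1) = 0"
      using assms(1) by (simp add: bcoeff_def)
    then show "\<forall>k\<in>{1..K} - {1..n + m}. (-1) ^ (k - 1) / of_nat k * bcoeff n m ((F - 1) ^ k) = 0"
      by (auto intro!: bcoeff_power_eq_0)
  qed (use assms(2) in auto)
  also have "\<dots> = (\<Sum>k<K. (-1) ^ k / of_nat (Suc k) * bcoeff n m ((F - 1) ^ Suc k))"
    by (rule sum.reindex_bij_witness[of _ Suc "\<lambda>k. k - 1"]) auto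
  finally show ?thesis .
qed

lemma bcoeff_deriv_power:
  "bcoeff n m (fps_deriv (F ^ Suc k)) = of_nat (Suc k) * bcoeff n m (fps_deriv F * F ^ k)"
proof -
  have "fps_deriv (F ^ Suc k) = of_nat (Suc k) * (fps_deriv F * F ^ k)"
    unfolding fps_deriv_power' by (simp only: diff_Suc_1 mult.assoc)
  then show ?thesis
    by (simp add: bcoeff_def fps_of_nat[symmetric] del: of_nat_Suc)
qed

text \<open>
  With \<open>F = 1 + u\<close>, the terms of the derivative of the logarithm are \<open>(- u)\<^sup>k F'\<close>. Cut off at
  \<open>K\<close>, their sum times \<open>F\<close> telescopes to \<open>F' - (- u)\<^sup>K F'\<close>, and the remainder vanishes in all
  coefficients of total degree below \<open>K\<close>.
\<close>

lemma deriv_bfps_log_mult: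
  assumes "bcoeff 0 0 F = 1"
  shows "fps_deriv (bfps_log F) * F = fps_deriv F"
proof (rule bfps_eqI)
  fix n m
  define u where "u = F - 1"
  \<comment> \<open>The coefficient of \<open>x^n y^m\<close> in the derivative comes from total degree \<open>n + m + 1\<close>.\<close>
  define K where "K = Suc (n + m)"
  define S where "S = (\<Sum>k<K. (- u) ^ k)"
  have u0: "bcoeff 0 0 u = 0"
    using assms by (simp add: u_def bcoeff_def)
  have du: "fps_deriv u = fps_deriv F"
    by (simp add: u_def)
  have "bcoeff i j (fps_deriv (bfps_log F)) = bcoeff i j (fps_deriv F * S)"
    if "i \<le> n" "j \<le> m" for i j
  proof -
    have "bcoeff i j (fps_deriv (bfps_log F))
        = of_nat (Suc i) * (\<Sum>k<K. (-1) ^ k / of_nat (Suc k) * bcoeff (Suc i) j (u ^ Suc k))"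
      unfolding bcoeff_deriv u_def
      by (subst bcoeff_log_truncate[OF assms, of _ _ K]) (use that in \<open>auto simp: K_def\<close>)
    also have "\<dots> = (\<Sum>k<K. (-1) ^ k / of_nat (Suc k) * bcoeff i j (fps_deriv (u ^ Suc k)))"
      unfolding bcoeff_deriv sum_distrib_left by (intro sum.cong refl) (simp only: mult_ac)
    also have "\<dots> = (\<Sum>k<K. (-1) ^ k * bcoeff i j (fps_deriv u * u ^ k))"
      unfolding bcoeff_deriv_power by (intro sum.cong refl) (simp del: of_nat_Suc)
    also have "\<dots> = (\<Sum>k<K. bcoeff i j (fps_deriv u * (- u) ^ k))"
    proof (intro sum.cong refl)
      show "(-1) ^ k * bcoeff i j (fps_deriv u * u ^ k) = bcoeff i j (fps_deriv u * (- u) ^ k)" for k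
        by (cases "even k") (simp_all add: bcoeff_def)
    qed
    also have "\<dots> = bcoeff i j (fps_deriv F * S)"
      by (simp add: S_def du bcoeff_def fps_sum_nth sum_distrib_left)
    finally show ?thesis .
  qed
  then have "bcoeff n m (fps_deriv (bfps_log F) * F) = bcoeff n m (fps_deriv F * S * F)"
    by (rule bcoeff_mult_cong)
  also have "fps_deriv F * S * F = fps_deriv F - (- u) ^ K * fps_deriv F"
  proof -
    have "F * S = 1 - (- u) ^ K"
      using one_diff_power_eq[of "- u" K] by (simp add: S_def u_def)
    then have "fps_deriv F * (F * S) = fps_deriv F * (1 - (- u) ^ K)"
      by simp
    then show ?thesis
      by (simp only: right_diff_distrib mult_1_right mult_1_left mult_ac)
  qed
  also have "bcoeff n m \<dots> = bcoeff n m (fps_deriv F)"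
  proof -
    have "bcoeff n m ((- u) ^ K * fps_deriv F) = bcoeff n m (0 * fps_deriv F)"
    proof (rule bcoeff_mult_cong)
      fix i j assume "i \<le> n" "j \<le> m"
      then have "bcoeff i j ((- u) ^ K) = 0"
        using u0 by (intro bcoeff_power_eq_0) (auto simp: K_def bcoeff_def)
      then show "bcoeff i j ((- u) ^ K) = bcoeff i j 0"
        by (simp add: bcoeff_def)
    qed
    then show ?thesis
      by (simp add: bcoeff_def)
  qed
  finally show "bcoeff n m (fps_deriv (bfps_log F) * F) = bcoeff n m (fps_deriv F)" .
qed

lemma bfps_log_nth_0:
  assumes "fps_nth F 0 = 1"
  shows "fps_nth (bfps_log F) 0 = 0"
proof (rule fps_ext)
  fix m
  have "bcoeff 0 m ((F - 1) ^ k) = 0" if "k \<ge> 1" for k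
    using assms that by (simp add: bcoeff_def fps_power_zeroth power_0_left)
  then show "fps_nth (fps_nth (bfps_log F) 0) m = fps_nth 0 m"
    by (simp add: bfps_log_def)
qed

section \<open>The logarithm of the product\<close>

definition geometric_x :: bfps where
  "geometric_x = Abs_fps (\<lambda>n. 1)"

definition geometric_xy :: bfps where
  "geometric_xy = Abs_fps (\<lambda>n. fps_X ^ n)"

lemma geometric_x_mult: "geometric_x * (1 - bfps_X) = 1"
proof (rule fps_ext)
  fix n show "fps_nth (geometric_x * (1 - bfps_X)) n = fps_nth 1 n"
    by (cases n) (simp_all add: geometric_x_def bfps_X_def right_diff_distrib)
qed

lemma geometric_xy_mult: "geometric_xy * (1 - bfps_X * bfps_Y) = 1"
proof (rule fps_ext)
  fix n show "fps_nth (geometric_xy * (1 - bfps_X * bfps_Y)) n = fps_nth 1 n"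
    by (cases n) (simp_all add: geometric_xy_def bfps_X_def bfps_Y_def right_diff_distrib
        mult.assoc[symmetric])
qed

text \<open>
  The quotient \<open>F' / F\<close> for \<open>F = (1 - x) (1 - x y)\<close> is
  \<open>- 1 / (1 - x) - y / (1 - x y)\<close>, and the logarithm is its integral without constant term.
\<close>

lemma log_product_nth:
  "fps_nth (bfps_log ((1 - bfps_X) * (1 - bfps_X * bfps_Y))) n
     = - fps_const (1 / of_nat n) * (if n = 0 then 0 else 1 + fps_X ^ n)"
proof -
  let ?F = "(1 - bfps_X) * (1 - bfps_X * bfps_Y)"
  let ?L = "bfps_log ?F"
  have F0: "fps_nth ?F 0 = 1"
    by (simp add: bfps_X_def)
  have dF: "fps_deriv ?F = - (1 - bfps_X * bfps_Y) - bfps_Y * (1 - bfps_X)"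
    by (simp add: bfps_X_def bfps_Y_def algebra_simps)
  have "fps_deriv ?L * ?F = fps_deriv ?F"
    by (rule deriv_bfps_log_mult) (use F0 in \<open>simp add: bcoeff_def\<close>)
  also have "\<dots> = (- geometric_x - bfps_Y * geometric_xy) * ?F"
    unfolding dF using geometric_x_mult geometric_xy_mult by algebra
  finally have dL: "fps_deriv ?L = - geometric_x - bfps_Y * geometric_xy"
    using F0 mult_right_cancel[of ?F] by fastforce
  show ?thesis
  proof (cases n)
    case 0
    then show ?thesis
      using bfps_log_nth_0[OF F0] by simp
  next
    case (Suc k)
    have "of_nat n * fps_nth ?L n = fps_nth (fps_deriv ?L) k"
      by (simp add: Suc)
    also have "\<dots> = - (1 + fps_X ^ n)"
      unfolding dL by (simp add: Suc geometric_x_def geometric_xy_def bfps_Y_def)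
    finally have "fps_const (1 / of_nat n) * (fps_const (of_nat n) * fps_nth ?L n)
        = - fps_const (1 / of_nat n) * (1 + fps_X ^ n)"
      by (simp only: fps_of_nat mult_minus_left mult_minus_right)
    then show ?thesis
      by (simp add: Suc mult.assoc[symmetric] del: of_nat_Suc)
  qed
qed

section \<open>Rows of reciprocal binomial coefficients\<close>

definition reciprocal_row :: "nat \<Rightarrow> complex fps" where
  "reciprocal_row n = Abs_fps (\<lambda>m. if m \<le> n then 1 / of_nat (n choose m) else 0)"

text \<open>
  Absorption writes both binomial coefficients on the left as multiples of \<open>n choose k\<close>:
  the reciprocals become \<open>k + 1\<close> and \<open>n + 1 - k\<close> over \<open>(n + 1) (n choose k)\<close>, and
  the numerators add up to \<open>n + 2\<close>.
\<close>

lemma reciprocal_binomial_add: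
  assumes "k \<le> n"
  shows "1 / of_nat (Suc n choose Suc k) + 1 / of_nat (Suc n choose k)
       = of_nat (n + 2) / of_nat (Suc n) * (1 / of_nat (n choose k) :: 'a :: field_char_0)"
proof -
  have nz: "of_nat (n choose k) \<noteq> (0::'a)" "of_nat (Suc n choose k) \<noteq> (0::'a)"
    "of_nat (Suc n choose Suc k) \<noteq> (0::'a)"
    using assms by (simp_all only: of_nat_eq_0_iff binomial_eq_0_iff not_less not_less_eq)
  have "Suc k * (Suc n choose Suc k) = Suc n * (n choose k)"
    by (rule Suc_times_binomial)
  then have "of_nat (Suc k) * of_nat (Suc n choose Suc k) = (of_nat (Suc n) * of_nat (n choose k) :: 'a)"
    by (simp only: of_nat_mult[symmetric])
  then have 1: "1 / of_nat (Suc n choose Suc k)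
      = (of_nat (Suc k) / (of_nat (Suc n) * of_nat (n choose k)) :: 'a)"
    using nz by (simp add: field_simps del: of_nat_Suc binomial_Suc_Suc)
  have "(Suc n - k) * (Suc n choose k) = Suc n * (n choose k)"
    using binomial_absorb_comp[of "Suc n" k] by simp
  then have "of_nat (Suc n - k) * of_nat (Suc n choose k) = (of_nat (Suc n) * of_nat (n choose k) :: 'a)"
    by (simp only: of_nat_mult[symmetric])
  then have 2: "1 / of_nat (Suc n choose k)
      = (of_nat (Suc n - k) / (of_nat (Suc n) * of_nat (n choose k)) :: 'a)"
    using nz by (simp add: field_simps del: of_nat_Suc binomial_Suc_Suc)
  have "of_nat (Suc k) + of_nat (Suc n - k) = (of_nat (n + 2) :: 'a)"
    using assms by (simp only: of_nat_add[symmetric]) (simp add: Suc_diff_le)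
  then show ?thesis
    unfolding 1 2 by (simp add: add_divide_distrib[symmetric] del: of_nat_Suc)
qed

lemma reciprocal_row_0: "reciprocal_row 0 = 1"
  by (rule fps_ext) (auto simp: reciprocal_row_def)

text \<open>
  The interior coefficients are \<open>reciprocal_binomial_add\<close>; the summands \<open>1\<close> and \<open>y^(n+2)\<close>
  are the two ends of the row, where a neighbour is missing.
\<close>

lemma reciprocal_row_Suc:
  "(1 + fps_X) * reciprocal_row (Suc n)
     = 1 + fps_X ^ (n + 2) + fps_const (of_nat (n + 2) / of_nat (Suc n)) * (fps_X * reciprocal_row n)"
proof (rule fps_ext)
  fix m
  show "fps_nth ((1 + fps_X) * reciprocal_row (Suc n)) m
      = fps_nth (1 + fps_X ^ (n + 2)
          + fps_const (of_nat (n + 2) / of_nat (Suc n)) * (fps_X * reciprocal_row n)) m"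
  proof (cases m)
    case 0
    then show ?thesis
      by (simp add: reciprocal_row_def distrib_right fps_X_power_iff)
  next
    case (Suc k)
    consider "k \<le> n" | "k = Suc n" | "k > Suc n" by linarith
    then show ?thesis
    proof cases
      case 1
      then show ?thesis
        using reciprocal_binomial_add[OF 1, where 'a = complex]
        by (auto simp: Suc reciprocal_row_def distrib_right fps_X_power_iff
            simp del: of_nat_Suc binomial_Suc_Suc)
    qed (simp_all add: Suc reciprocal_row_def distrib_right fps_X_power_iff)
  qed
qed

section \<open>The generating function\<close>

definition reciprocal_triangle :: bfps where
  "reciprocal_triangle = Abs_fps reciprocal_row"

text \<open>
  The two multiplications by \<open>D\<close> are carried out one after the other, because
  \<open>reciprocal_row_Suc\<close> applies once at each stage: first it trades the row \<open>n + 1\<close> for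
  \<open>y / (n+1)\<close> times the row \<open>n\<close>, and then it makes the remaining rows cancel. The right-hand side is
  \<open>- y L + x y\<^sup>2 D / (1 - x y) + D\<^sup>2 / (1 - x)\<close>, where \<open>L\<close> is the logarithm, expanded so that
  every coefficient is explicit.
\<close>

lemma reciprocal_triangle_mult:
  defines "D \<equiv> 1 + bfps_Y - bfps_X * bfps_Y"
  shows "reciprocal_triangle * D ^ 2
     = - bfps_Y * bfps_log ((1 - bfps_X) * (1 - bfps_X * bfps_Y))
       + bfps_X * bfps_Y ^ 3 * geometric_xy + geometric_x + 2 * bfps_Y + bfps_Y ^ 2"
    (is "_ = ?R")
proof -
  have D_mult: "fps_nth (H * D) 0 = (1 + fps_X) * fps_nth H 0"
    "fps_nth (H * D) (Suc n) = (1 + fps_X) * fps_nth H (Suc n) - fps_X * fps_nth H n" for H :: bfps and n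
  proof -
    have "H * D = fps_const (1 + fps_X) * H - fps_const fps_X * (fps_X * H)"
      unfolding D_def bfps_X_def bfps_Y_def fps_const_add[symmetric] fps_const_1_eq_1
      by (simp only: algebra_simps)
    then show "fps_nth (H * D) 0 = (1 + fps_X) * fps_nth H 0"
      "fps_nth (H * D) (Suc n) = (1 + fps_X) * fps_nth H (Suc n) - fps_X * fps_nth H n"
      by simp_all
  qed
  define C where "C = reciprocal_triangle * D"
  have C_0: "fps_nth C 0 = 1 + fps_X"
    unfolding C_def D_mult by (simp add: reciprocal_triangle_def reciprocal_row_0)
  have C_Suc: "fps_nth C (Suc n)
      = 1 + fps_X ^ (n + 2) + fps_const (1 / of_nat (Suc n)) * (fps_X * reciprocal_row n)" for n
  proof -
    have "of_nat (n + 2) / of_nat (Suc n) = 1 + 1 / (of_nat (Suc n) :: complex)"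
      by (simp add: field_simps del: of_nat_Suc) simp
    then have split: "fps_const (of_nat (n + 2) / of_nat (Suc n)) = 1 + fps_const (1 / (of_nat (Suc n) :: complex))"
      by (simp only: fps_const_add[symmetric] fps_const_1_eq_1)
    then show ?thesis
      unfolding C_def D_mult reciprocal_triangle_def fps_nth_Abs_fps reciprocal_row_Suc split
      by (simp add: algebra_simps del: of_nat_Suc)
  qed
  define L where "L = bfps_log ((1 - bfps_X) * (1 - bfps_X * bfps_Y))"
  note L_nth = log_product_nth[folded L_def]
  have R_0: "fps_nth ?R 0 = 1 + 2 * fps_X + fps_X ^ 2"
    unfolding L_def[symmetric]
    by (simp add: L_nth geometric_x_def bfps_X_def bfps_Y_def mult.assoc
        fps_const_power numeral_fps_const)
  have R_Suc: "fps_nth ?R (Suc n) = fps_const (1 / of_nat (Suc n)) * (fps_X * (1 + fps_X ^ Suc n))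
      + fps_X ^ (n + 3) + 1" for n
    unfolding L_def[symmetric]
    by (simp add: L_nth geometric_x_def geometric_xy_def bfps_X_def bfps_Y_def mult.assoc
        fps_const_power numeral_fps_const power_add algebra_simps power3_eq_cube fps_const_neg[symmetric]
        del: of_nat_Suc fps_const_neg)
  have "fps_nth (C * D) n = fps_nth ?R n" for n
  proof (cases n)
    case 0
    then show ?thesis
      unfolding 0 R_0 D_mult C_0 by (simp add: algebra_simps power2_eq_square)
  next
    case (Suc k)
    show ?thesis
    proof (cases k)
      case 0
      then show ?thesis
        unfolding Suc R_Suc D_mult 0 C_Suc C_0
        by (simp add: reciprocal_row_0 algebra_simps power2_eq_square numeral_eq_Suc)
    next
      case (Suc l)
      define a b c :: "complex fps"
        where "a = fps_const (1 / of_nat (Suc k))" and "b = fps_const (1 / of_nat (Suc l))"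
          and "c = fps_const (of_nat (l + 2) / of_nat (Suc l))"
      define q :: "complex fps" where "q = fps_X ^ Suc k"
      \<comment> \<open>The denominator \<open>k + 1\<close> cancels against the numerator \<open>l + 2\<close> of the recurrence, so
        both multiplications by \<open>D\<close> yield the same multiple of row \<open>l\<close>.\<close>
      have "a * c = b"
        using Suc by (simp add: a_def b_def c_def del: of_nat_Suc)
      have rec: "(1 + fps_X) * reciprocal_row k = 1 + q + c * (fps_X * reciprocal_row l)"
        unfolding c_def q_def Suc by (simp only: reciprocal_row_Suc) simp
      have C_n: "fps_nth C (Suc k) = 1 + fps_X * q + a * (fps_X * reciprocal_row k)"
        unfolding C_Suc a_def q_def by simp
      have C_k: "fps_nth C k = 1 + q + b * (fps_X * reciprocal_row l)"
        unfolding Suc C_Suc b_def q_def by simp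
      have "fps_nth (C * D) n
          = (1 + fps_X) * (1 + fps_X * q + a * (fps_X * reciprocal_row k))
            - fps_X * (1 + q + b * (fps_X * reciprocal_row l))"
        unfolding \<open>n = Suc k\<close> D_mult C_n C_k ..
      also have "\<dots> = 1 + fps_X ^ 2 * q
          + fps_X * (a * ((1 + fps_X) * reciprocal_row k) - b * (fps_X * reciprocal_row l))"
        by (simp add: algebra_simps power2_eq_square)
      also have "\<dots> = a * (fps_X * (1 + q)) + fps_X ^ 2 * q + 1"
        unfolding rec \<open>a * c = b\<close>[symmetric] by (simp add: algebra_simps)
      also have "\<dots> = fps_nth ?R n"
        unfolding \<open>n = Suc k\<close> R_Suc a_def q_def by (simp add: numeral_eq_Suc mult.assoc)
      finally show ?thesis .
    qed
  qed
  then show ?thesis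
    by (simp add: C_def power2_eq_square mult.assoc fps_eq_iff)
qed

lemma A_series_eq_reciprocal_triangle: "A_series = reciprocal_triangle"
proof -
  define D where "D = 1 + bfps_Y - bfps_X * bfps_Y"
  define P where "P = 1 - bfps_X * bfps_Y"
  define L where "L = bfps_log ((1 - bfps_X) * (1 - bfps_X * bfps_Y))"
  note vars = D_def P_def bfps_X_def bfps_Y_def bcoeff_def
  have 1: "bfps_Y * L / D ^ 2 * D ^ 2 = bfps_Y * L"
    by (rule bfps_divide_mult) (simp add: vars fps_power_zeroth)
  have 2: "bfps_X * bfps_Y ^ 2 / (P * D) * (P * D) = bfps_X * bfps_Y ^ 2"
    by (rule bfps_divide_mult) (simp add: vars)
  have 3: "1 / (1 - bfps_X) * (1 - bfps_X) = 1"
    by (rule bfps_divide_mult) (simp add: vars)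
  have "fps_nth (fps_nth D 0) 0 \<noteq> 0"
    by (simp add: vars)
  then have "D \<noteq> 0"
    by auto
  have term3: "1 / (1 - bfps_X) = geometric_x"
    using 3 geometric_x_mult by algebra
  have term2: "bfps_X * bfps_Y ^ 2 / (P * D) * D = bfps_X * bfps_Y ^ 2 * geometric_xy"
    using 2 geometric_xy_mult unfolding P_def by algebra
  have "A_series * D ^ 2 = - (bfps_Y * L / D ^ 2 * D ^ 2)
      + (bfps_X * bfps_Y ^ 2 / (P * D) * D) * D + 1 / (1 - bfps_X) * D ^ 2"
    unfolding A_series_def Let_def D_def[symmetric] P_def[symmetric] L_def
    by (simp add: power2_eq_square algebra_simps)
  also have "\<dots> = - bfps_Y * L + bfps_X * bfps_Y ^ 3 * geometric_xy + geometric_x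
      + 2 * bfps_Y + bfps_Y ^ 2"
    unfolding 1 term2 term3 using geometric_x_mult geometric_xy_mult unfolding D_def by algebra
  also have "\<dots> = reciprocal_triangle * D ^ 2"
    using reciprocal_triangle_mult by (simp add: D_def L_def)
  finally show ?thesis
    using \<open>D \<noteq> 0\<close> by simp
qed

theorem theorem3p1:
  shows "(\<forall>n m. m \<le> n \<longrightarrow> bcoeff n m A_series = 1 / of_nat (n choose m))
    \<and> (\<forall>n m. m > n \<longrightarrow> bcoeff n m A_series = 0)
    \<and> (\<lambda>n. \<Sum>m = 0..n. bfps_const (1 / of_nat (n choose m)) * bfps_X ^ n * bfps_Y ^ m) sums A_series"
proof (intro conjI)
  have "(\<Sum>m = 0..n. bfps_const (1 / of_nat (n choose m)) * bfps_X ^ n * bfps_Y ^ m)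
      = fps_const (fps_nth reciprocal_triangle n) * fps_X ^ n" for n
  proof (rule bfps_eqI)
    fix i j
    have "bcoeff i j (\<Sum>m = 0..n. bfps_const (1 / of_nat (n choose m)) * bfps_X ^ n * bfps_Y ^ m)
        = (\<Sum>m = 0..n. if j = m then if i = n then 1 / of_nat (n choose m) else 0 else 0)"
      unfolding bcoeff_sum by (intro sum.cong refl) (simp add: bcoeff_monomial)
    also have "\<dots> = bcoeff i j (fps_const (fps_nth reciprocal_triangle n) * fps_X ^ n)"
      by (simp add: bcoeff_def fps_X_power_iff reciprocal_triangle_def reciprocal_row_def)
    finally show "bcoeff i j (\<Sum>m = 0..n.
          bfps_const (1 / of_nat (n choose m)) * bfps_X ^ n * bfps_Y ^ m)
        = bcoeff i j (fps_const (fps_nth reciprocal_triangle n) * fps_X ^ n)" .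
  qed
  then show "(\<lambda>n. \<Sum>m = 0..n. bfps_const (1 / of_nat (n choose m)) * bfps_X ^ n * bfps_Y ^ m)
      sums A_series"
    using fps_notation[of reciprocal_triangle]
    by (simp add: sums_def_le A_series_eq_reciprocal_triangle atLeast0AtMost)
qed (simp_all add: A_series_eq_reciprocal_triangle reciprocal_triangle_def reciprocal_row_def bcoeff_def)

end
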